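(* Let $P=(\mathcal{S},\vec{T}_U,\vec{T}_Q)$ and $P'=(\mathcal{S}',\vec{T}_U',\vec{T}_Q')$ be database-driven programs with $|\vec T_U'|\ge|\vec T_U|$ and $|\vec T_Q'|\ge|\vec T_Q|$. Suppose an oracle is available for proving any valid Hoare triple and any valid logical entailment (so that inductiveness and projective sufficiency are understood semantically). If $P'\preceq P$, then there exists a projectively sufficient and inductive simulation invariant $\Phi$ for $P$ and $P'$.
   Context: A database-driven program is a triple $P=(\mathcal{S},\vec{T}_U,\vec{T}_Q)$. The schema $\mathcal{S}$ maps finitely many relation names $R$ to record types $\{a_1:\tau_1;\dots;a_n:\tau_n\}$. $\vec{T}_U=(U_1,\dots,U_m)$ is a list of update transactions $\lambda\vec v.\,U$ and $\vec{T}_Q=(Q_1,\dots,Q_l)$ a list of query transactions $\lambda\vec v.\,Q$, with $U ::= \mathtt{ins}(R,\{a_1:v_1,\dots,a_n:v_n\}) \mid \mathtt{del}(R,\phi)\mid \mathtt{upd}(R,\phi,a,v)\mid U;U$, $Q ::= R\mid \Pi_\psi(Q)\mid \sigma_\phi(Q)\mid Q\bowtie_\phi Q\mid Q\cup Q\mid Q-Q$, where $\psi$ is a nonempty list of attributes, $\phi$ is a boolean combination ($\wedge,\vee,\neg$) of atoms $a\odot a'$, $a\odot v$, $a\in Q$ with $\odot\in\{\le,<,=,\ne,>,\ge\}$, and $v$ ranges over parameter variables and constants. A database instance $\Delta$ maps each relation name to a finite list of tuples; a tuple is a finite map from attribute names to values, viewed as a list of (attribute, value) pairs. A valuation $\sigma$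 maps parameter variables to values; $v[\sigma]$ is the value of $v$. Semantics of updates: $[\![U_1;U_2]\!]_{\sigma,\Delta}=[\![U_2]\!]_{\sigma,[\![U_1]\!]_{\sigma,\Delta}}$; $\mathtt{ins}(R,t)$ appends the tuple $t[\sigma]$ to the end of $\Delta(R)$; $\mathtt{del}(R,\phi)$ replaces $\Delta(R)$ by the sublist (order preserved) of tuples $x$ with $[\![\phi]\!]_{\sigma,\Delta,x}$ false; $\mathtt{upd}(R,\phi,a,v)$ replaces $\Delta(R)$ by the list of tuples not satisfying $\phi$ (in order) followed by the list of tuples satisfying $\phi$ (in order), each with attribute $a$ set to $v[\sigma]$. Semantics of queries: $[\![R]\!]_{\sigma,\Delta}=\Delta(R)$; $\Pi_\psi$ restricts each tuple to the attributes in $\psi$; $\sigma_\phi$ keeps the tuples $x$ with $[\![\phi]\!]_{\sigma,\Delta,x}$ true; $Q_1\times Q_2$ lists, for each $y$ of $[\![Q_1]\!]$ in order and each $z$ of $[\![Q_2]\!]$ in order, the merged map $y\cup z$ (keys disjoint); $Q_1\bowtie_\phi Q_2=\sigma_\phi(Q_1\times Q_2)$; $\cup$ is list concatenation; $Q_1-Q_2$ starts from $[\![Q_1]\!]$ and, for each element $y$ of $[\![Q_2]\!]$ in order, deletes the first occurrence of $y$ (if any). Predicates on a tuple $x$: $a\odot a'$ compares $x(a),x(a')$; $a\odot v$ compares $x(a)$ with $v[\sigma]$; $a\in Q$ holds iff $x(a)$ occurs in the list of first values of the tuples of $[\![Q]\!]_{\sigma,\Delta}$; connectives are standard. An invocation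 sequence is $\omega=(i_1,\sigma_1);\dots;(i_n,\sigma_n)$, $n\ge1$, where for $j<n$, $i_j$ is the index of an update transaction and $\sigma_j$ a valuation of its parameters, and $i_n$ is the index of a query transaction with valuation $\sigma_n$. $[\![P]\!]_{\omega,\Delta}$ is obtained by applying $U_{i_1}$ under $\sigma_1$ to $\Delta$, then $U_{i_2}$ under $\sigma_2$, etc., yielding $\Delta''$, and returning the list obtained by mapping each tuple of $[\![Q_{i_n}]\!]_{\sigma_n,\Delta''}$ to its list of values. $[\![P]\!]_\omega=[\![P]\!]_{\omega,\Delta_\emptyset}$ where $\Delta_\emptyset$ maps every relation to the empty list. Refinement: for each shared index $i$, the parameters $\vec x=(x_1,\dots,x_k)$ of the $i$-th transaction of $P$ correspond to the first $k$ parameters $y_1,\dots,y_k$ of the $i$-th transaction of $P'$ (which may have more parameters). A valuation $\sigma'$ refines $\sigma$, $\sigma'\preceq\sigma$, if $\sigma'$ gives every variable of $\mathrm{dom}(\sigma)$ (i.e. each $y_j$ corresponding to $x_j$) the same value as $\sigma$. For invocation sequences $\omega=(i_1,\sigma_1)\dots(i_n,\sigma_n)$ (valid for $P$) and $\omega'=(i'_1,\sigma'_1)\dots(i'_n,\sigma'_n)$ (valid for $P'$), $\omega'\preceq\omega$ iff $i_k=i'_k$ and $\sigma'_k\preceq\sigma_k$ for all $k\in[1,n]$. $P'\preceq P$ iff for all such $\omega,\omega'$ with $\omega'\preceq\omega$ there is an attribute list $L$ with $[\![\Pi_L(P')]\!]_{\omega'}=[\![P]\!]_\omega$, where $\Pi_L(P')$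 replaces each query $Q'_i$ of $P'$ by $\Pi_L(Q'_i)$. A simulation invariant is a relation $\Phi$ between instances of $\mathcal{S}$ and of $\mathcal{S}'$. It is inductive if (a) $\Phi(\Delta_\emptyset,\Delta'_\emptyset)$ and (b) for every $i\in[1,|\vec T_U|]$ the Hoare triple $\{\Phi\wedge\bigwedge_{x_j\in\vec x}x_j=y_j\}\,U_i;U_i'\,\{\Phi\}$ is valid (with $\vec x$ the parameters of $U_i$, $\vec y$ those of $U'_i$). It is projectively sufficient if for every $i\in[1,|\vec T_Q|]$, $(\Phi\wedge\bigwedge_{x_j\in\vec x}x_j=y_j)\models\exists L.\ Q_i=\Pi_L(Q'_i)$, i.e. whenever $\Phi(\Delta,\Delta')$ and the valuations agree on corresponding parameters, there is an attribute list $L$ such that the value lists of $[\![Q_i]\!]$ on $\Delta$ and $[\![\Pi_L(Q'_i)]\!]$ on $\Delta'$ coincide. *)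

theory Defs
  imports Main "HOL-Library.AList"
begin

section \<open>Syntax\<close>

text \<open>
  A type is represented by the set of its values. All values live in one linearly ordered
  type \<open>'v\<close>; taking every type to be \<open>UNIV\<close> gives the untyped reading.
\<close>

type_synonym 'v ty = "'v set"
type_synonym ('a, 'v) record_type = "('a \<times> 'v ty) list"
type_synonym ('r, 'a, 'v) schema = "'r \<rightharpoonup> ('a, 'v) record_type"

datatype cmp = CLe | CLt | CEq | CNe | CGt | CGe

datatype ('x, 'v) arg = Var 'x | Const 'v

datatype ('r, 'a, 'x, 'v) pred =
    AttrCmp 'a cmp 'a
  | ArgCmp 'a cmp "('x, 'v) arg"
  | InQuery 'a "('r, 'a, 'x, 'v) query"
  | And "('r, 'a, 'x, 'v) pred" "('r, 'a, 'x, 'v) pred"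
  | Or "('r, 'a, 'x, 'v) pred" "('r, 'a, 'x, 'v) pred"
  | Neg "('r, 'a, 'x, 'v) pred"
and ('r, 'a, 'x, 'v) query =
    Rel 'r
  | Proj "'a list" "('r, 'a, 'x, 'v) query"
  | Sel "('r, 'a, 'x, 'v) pred" "('r, 'a, 'x, 'v) query"
  | Join "('r, 'a, 'x, 'v) pred" "('r, 'a, 'x, 'v) query" "('r, 'a, 'x, 'v) query"
  | Union "('r, 'a, 'x, 'v) query" "('r, 'a, 'x, 'v) query"
  | Diff "('r, 'a, 'x, 'v) query" "('r, 'a, 'x, 'v) query"

datatype ('r, 'a, 'x, 'v) update =
    Ins 'r "('a \<times> ('x, 'v) arg) list"
  | Del 'r "('r, 'a, 'x, 'v) pred"
  | Upd 'r "('r, 'a, 'x, 'v) pred" 'a "('x, 'v) arg"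
  | Seq "('r, 'a, 'x, 'v) update" "('r, 'a, 'x, 'v) update"

type_synonym ('x, 'v) params = "('x \<times> 'v ty) list"

record ('r, 'a, 'x, 'v) program =
  schema :: "('r, 'a, 'v) schema"
  updates :: "(('x, 'v) params \<times> ('r, 'a, 'x, 'v) update) list"
  queries :: "(('x, 'v) params \<times> ('r, 'a, 'x, 'v) query) list"


section \<open>Semantics\<close>

type_synonym ('a, 'v) tuple = "('a \<times> 'v) list"
type_synonym ('r, 'a, 'v) inst = "'r \<Rightarrow> ('a, 'v) tuple list"
type_synonym ('x, 'v) valuation = "'x \<rightharpoonup> 'v"

fun cmp_sem :: "cmp \<Rightarrow> 'v::linorder \<Rightarrow> 'v \<Rightarrow> bool" where
  "cmp_sem CLe u w \<longleftrightarrow> u \<le> w"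
| "cmp_sem CLt u w \<longleftrightarrow> u < w"
| "cmp_sem CEq u w \<longleftrightarrow> u = w"
| "cmp_sem CNe u w \<longleftrightarrow> u \<noteq> w"
| "cmp_sem CGt u w \<longleftrightarrow> u > w"
| "cmp_sem CGe u w \<longleftrightarrow> u \<ge> w"

fun arg_sem :: "('x, 'v) valuation \<Rightarrow> ('x, 'v) arg \<Rightarrow> 'v" where
  "arg_sem \<sigma> (Var x) = the (\<sigma> x)"
| "arg_sem \<sigma> (Const c) = c"

definition attr_val :: "('a, 'v) tuple \<Rightarrow> 'a \<Rightarrow> 'v" where
  "attr_val t a = the (map_of t a)"

primrec pred_sem ::
    "('x, 'v::linorder) valuation \<Rightarrow> ('r, 'a, 'v) inst \<Rightarrow> ('r, 'a, 'x, 'v) pred \<Rightarrow>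
     ('a, 'v) tuple \<Rightarrow> bool"
  and query_sem ::
    "('x, 'v) valuation \<Rightarrow> ('r, 'a, 'v) inst \<Rightarrow> ('r, 'a, 'x, 'v) query \<Rightarrow>
     ('a, 'v) tuple list"
where
  "pred_sem \<sigma> \<Delta> (AttrCmp a c b) = (\<lambda>t. cmp_sem c (attr_val t a) (attr_val t b))"
| "pred_sem \<sigma> \<Delta> (ArgCmp a c v) = (\<lambda>t. cmp_sem c (attr_val t a) (arg_sem \<sigma> v))"
| "pred_sem \<sigma> \<Delta> (InQuery a Q) =
     (\<lambda>t. attr_val t a \<in> set (map (\<lambda>u. snd (hd u)) (query_sem \<sigma> \<Delta> Q)))"
| "pred_sem \<sigma> \<Delta> (And p q) = (\<lambda>t. pred_sem \<sigma> \<Delta> p t \<and> pred_sem \<sigma> \<Delta> q t)"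
| "pred_sem \<sigma> \<Delta> (Or p q) = (\<lambda>t. pred_sem \<sigma> \<Delta> p t \<or> pred_sem \<sigma> \<Delta> q t)"
| "pred_sem \<sigma> \<Delta> (Neg p) = (\<lambda>t. \<not> pred_sem \<sigma> \<Delta> p t)"
| "query_sem \<sigma> \<Delta> (Rel R) = \<Delta> R"
| "query_sem \<sigma> \<Delta> (Proj as Q) = map (filter (\<lambda>(a, w). a \<in> set as)) (query_sem \<sigma> \<Delta> Q)"
| "query_sem \<sigma> \<Delta> (Sel p Q) = filter (pred_sem \<sigma> \<Delta> p) (query_sem \<sigma> \<Delta> Q)"
| "query_sem \<sigma> \<Delta> (Join p Q1 Q2) =
     filter (pred_sem \<sigma> \<Delta> p) [y @ z. y \<leftarrow> query_sem \<sigma> \<Delta> Q1, z \<leftarrow> query_sem \<sigma> \<Delta> Q2]"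
| "query_sem \<sigma> \<Delta> (Union Q1 Q2) = query_sem \<sigma> \<Delta> Q1 @ query_sem \<sigma> \<Delta> Q2"
| "query_sem \<sigma> \<Delta> (Diff Q1 Q2) = fold remove1 (query_sem \<sigma> \<Delta> Q2) (query_sem \<sigma> \<Delta> Q1)"

primrec update_sem ::
    "('x, 'v::linorder) valuation \<Rightarrow> ('r, 'a, 'x, 'v) update \<Rightarrow> ('r, 'a, 'v) inst \<Rightarrow>
     ('r, 'a, 'v) inst"
where
  "update_sem \<sigma> (Ins R t) \<Delta> = \<Delta>(R := \<Delta> R @ [map (\<lambda>(a, v). (a, arg_sem \<sigma> v)) t])"
| "update_sem \<sigma> (Del R p) \<Delta> = \<Delta>(R := filter (\<lambda>t. \<not> pred_sem \<sigma> \<Delta> p t) (\<Delta> R))"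
| "update_sem \<sigma> (Upd R p a v) \<Delta> =
     \<Delta>(R := filter (\<lambda>t. \<not> pred_sem \<sigma> \<Delta> p t) (\<Delta> R) @
            map (AList.update a (arg_sem \<sigma> v)) (filter (pred_sem \<sigma> \<Delta> p) (\<Delta> R)))"
| "update_sem \<sigma> (Seq U1 U2) \<Delta> = update_sem \<sigma> U2 (update_sem \<sigma> U1 \<Delta>)"

definition values_of :: "('a, 'v) tuple list \<Rightarrow> 'v list list" where
  "values_of = map (map snd)"

definition empty_inst :: "('r, 'a, 'v) inst" where
  "empty_inst = (\<lambda>R. [])"


section \<open>Well-formedness over a schema\<close>

text \<open>
  These conditions ensure that every clause of the semantics is meaningful: names are
  declared, looked-up attributes and parameters exist, joined tuples have disjoint keys, and
  stored values have the declared types. \<open>shapes S Q\<close> collects the attribute lists that tuples of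
  the result of \<open>Q\<close> may have; there can be several, since the operands of \<open>Union\<close> are not required to
  have the same attributes.
\<close>

fun shapes :: "('r, 'a, 'v) schema \<Rightarrow> ('r, 'a, 'x, 'v) query \<Rightarrow> 'a list set" where
  "shapes S (Rel R) = (case S R of None \<Rightarrow> {} | Some rt \<Rightarrow> {map fst rt})"
| "shapes S (Proj as Q) = filter (\<lambda>a. a \<in> set as) ` shapes S Q"
| "shapes S (Sel p Q) = shapes S Q"
| "shapes S (Join p Q1 Q2) = {k @ l | k l. k \<in> shapes S Q1 \<and> l \<in> shapes S Q2}"
| "shapes S (Union Q1 Q2) = shapes S Q1 \<union> shapes S Q2"
| "shapes S (Diff Q1 Q2) = shapes S Q1"

definition scope :: "('r, 'a, 'v) schema \<Rightarrow> ('r, 'a, 'x, 'v) query \<Rightarrow> 'a set" where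
  "scope S Q = {a. \<forall>k \<in> shapes S Q. a \<in> set k}"

fun arg_declared :: "('x, 'v) params \<Rightarrow> ('x, 'v) arg \<Rightarrow> bool" where
  "arg_declared ps (Var x) \<longleftrightarrow> x \<in> fst ` set ps"
| "arg_declared ps (Const c) \<longleftrightarrow> True"

fun arg_has_type :: "('x, 'v) params \<Rightarrow> ('x, 'v) arg \<Rightarrow> 'v ty \<Rightarrow> bool" where
  "arg_has_type ps (Var x) T \<longleftrightarrow> (\<exists>T'. (x, T') \<in> set ps \<and> T' \<subseteq> T)"
| "arg_has_type ps (Const c) T \<longleftrightarrow> c \<in> T"

primrec wf_pred ::
    "('r, 'a, 'v) schema \<Rightarrow> ('x, 'v) params \<Rightarrow> ('r, 'a, 'x, 'v) pred \<Rightarrow> 'a set \<Rightarrow> bool"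
  and wf_query ::
    "('r, 'a, 'v) schema \<Rightarrow> ('x, 'v) params \<Rightarrow> ('r, 'a, 'x, 'v) query \<Rightarrow> bool"
where
  "wf_pred S ps (AttrCmp a c b) = (\<lambda>A. a \<in> A \<and> b \<in> A)"
| "wf_pred S ps (ArgCmp a c v) = (\<lambda>A. a \<in> A \<and> arg_declared ps v)"
| "wf_pred S ps (InQuery a Q) = (\<lambda>A. a \<in> A \<and> wf_query S ps Q \<and> [] \<notin> shapes S Q)"
| "wf_pred S ps (And p q) = (\<lambda>A. wf_pred S ps p A \<and> wf_pred S ps q A)"
| "wf_pred S ps (Or p q) = (\<lambda>A. wf_pred S ps p A \<and> wf_pred S ps q A)"
| "wf_pred S ps (Neg p) = (\<lambda>A. wf_pred S ps p A)"
| "wf_query S ps (Rel R) \<longleftrightarrow> R \<in> dom S"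
| "wf_query S ps (Proj as Q) \<longleftrightarrow> as \<noteq> [] \<and> wf_query S ps Q"
| "wf_query S ps (Sel p Q) \<longleftrightarrow> wf_query S ps Q \<and> wf_pred S ps p (scope S Q)"
| "wf_query S ps (Join p Q1 Q2) \<longleftrightarrow>
     wf_query S ps Q1 \<and> wf_query S ps Q2 \<and>
     (\<forall>k \<in> shapes S Q1. \<forall>l \<in> shapes S Q2. set k \<inter> set l = {}) \<and>
     wf_pred S ps p (scope S (Join p Q1 Q2))"
| "wf_query S ps (Union Q1 Q2) \<longleftrightarrow> wf_query S ps Q1 \<and> wf_query S ps Q2"
| "wf_query S ps (Diff Q1 Q2) \<longleftrightarrow> wf_query S ps Q1 \<and> wf_query S ps Q2"

fun wf_update ::
    "('r, 'a, 'v) schema \<Rightarrow> ('x, 'v) params \<Rightarrow> ('r, 'a, 'x, 'v) update \<Rightarrow> bool"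
where
  "wf_update S ps (Ins R t) \<longleftrightarrow>
     (\<exists>rt. S R = Some rt \<and>
        list_all2 (\<lambda>(a, v) (b, T). a = b \<and> arg_has_type ps v T) t rt)"
| "wf_update S ps (Del R p) \<longleftrightarrow>
     (\<exists>rt. S R = Some rt \<and> wf_pred S ps p (fst ` set rt))"
| "wf_update S ps (Upd R p a v) \<longleftrightarrow>
     (\<exists>rt T. S R = Some rt \<and> wf_pred S ps p (fst ` set rt) \<and>
        (a, T) \<in> set rt \<and> arg_has_type ps v T)"
| "wf_update S ps (Seq U1 U2) \<longleftrightarrow> wf_update S ps U1 \<and> wf_update S ps U2"

definition wf_schema :: "('r, 'a, 'v) schema \<Rightarrow> bool" where
  "wf_schema S \<longleftrightarrow> finite (dom S) \<and> (\<forall>rt \<in> ran S. distinct (map fst rt))"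

definition database_program :: "('r, 'a, 'x, 'v) program \<Rightarrow> bool" where
  "database_program P \<longleftrightarrow>
     wf_schema (schema P) \<and>
     (\<forall>(ps, U) \<in> set (updates P). distinct (map fst ps) \<and> wf_update (schema P) ps U) \<and>
     (\<forall>(ps, Q) \<in> set (queries P). distinct (map fst ps) \<and> wf_query (schema P) ps Q)"

definition instances :: "('r, 'a, 'v) schema \<Rightarrow> ('r, 'a, 'v) inst set" where
  "instances S = {\<Delta>. \<forall>R.
     (case S R of
        None \<Rightarrow> \<Delta> R = []
      | Some rt \<Rightarrow> \<forall>t \<in> set (\<Delta> R). list_all2 (\<lambda>(a, w) (b, T). a = b \<and> w \<in> T) t rt)}"

definition valuation_of :: "('x, 'v) params \<Rightarrow> ('x, 'v) valuation \<Rightarrow> bool" where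
  "valuation_of ps \<sigma> \<longleftrightarrow>
     dom \<sigma> = fst ` set ps \<and> (\<forall>(x, T) \<in> set ps. the (\<sigma> x) \<in> T)"


section \<open>Invocation sequences\<close>

text \<open>
  An invocation sequence is split into its list of update invocations and its final query
  invocation. Transactions are indexed from 0.
\<close>

type_synonym ('x, 'v) invocation = "nat \<times> ('x, 'v) valuation"
type_synonym ('x, 'v) invocation_seq = "('x, 'v) invocation list \<times> ('x, 'v) invocation"

definition valid_seq :: "('r, 'a, 'x, 'v) program \<Rightarrow> ('x, 'v) invocation_seq \<Rightarrow> bool" where
  "valid_seq P \<omega> \<longleftrightarrow>
     (\<forall>(i, \<sigma>) \<in> set (fst \<omega>). i < length (updates P) \<and> valuation_of (fst (updates P ! i)) \<sigma>) \<and>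
     (case snd \<omega> of (i, \<sigma>) \<Rightarrow> i < length (queries P) \<and> valuation_of (fst (queries P ! i)) \<sigma>)"

definition run_updates ::
    "('r, 'a, 'x, 'v::linorder) program \<Rightarrow> ('x, 'v) invocation list \<Rightarrow>
     ('r, 'a, 'v) inst \<Rightarrow> ('r, 'a, 'v) inst"
where
  "run_updates P = fold (\<lambda>(i, \<sigma>). update_sem \<sigma> (snd (updates P ! i)))"

definition run_from ::
    "('r, 'a, 'x, 'v::linorder) program \<Rightarrow> ('x, 'v) invocation_seq \<Rightarrow>
     ('r, 'a, 'v) inst \<Rightarrow> 'v list list"
where
  "run_from P \<omega> \<Delta> =
     (case \<omega> of (us, (i, \<sigma>)) \<Rightarrow>
        values_of (query_sem \<sigma> (run_updates P us \<Delta>) (snd (queries P ! i))))"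

definition run ::
    "('r, 'a, 'x, 'v::linorder) program \<Rightarrow> ('x, 'v) invocation_seq \<Rightarrow> 'v list list"
where
  "run P \<omega> = run_from P \<omega> empty_inst"


section \<open>Refinement\<close>

definition params_correspond ::
    "('r, 'a, 'x, 'v) program \<Rightarrow> ('s, 'b, 'y, 'v) program \<Rightarrow> bool"
where
  "params_correspond P P' \<longleftrightarrow>
     (\<forall>i < min (length (updates P)) (length (updates P')).
        length (fst (updates P ! i)) \<le> length (fst (updates P' ! i))) \<and>
     (\<forall>i < min (length (queries P)) (length (queries P')).
        length (fst (queries P ! i)) \<le> length (fst (queries P' ! i)))"

definition refines_valuation ::
    "('x, 'v) params \<Rightarrow> ('y, 'v) params \<Rightarrow>
     ('y, 'v) valuation \<Rightarrow> ('x, 'v) valuation \<Rightarrow> bool"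
where
  "refines_valuation xs ys \<sigma>' \<sigma> \<longleftrightarrow>
     (\<forall>j < length xs. \<sigma>' (fst (ys ! j)) = \<sigma> (fst (xs ! j)))"

definition refines_seq ::
    "('r, 'a, 'x, 'v) program \<Rightarrow> ('s, 'b, 'y, 'v) program \<Rightarrow>
     ('y, 'v) invocation_seq \<Rightarrow> ('x, 'v) invocation_seq \<Rightarrow> bool"
where
  "refines_seq P P' \<omega>' \<omega> \<longleftrightarrow>
     list_all2 (\<lambda>(i', \<sigma>') (i, \<sigma>). i = i' \<and>
         refines_valuation (fst (updates P ! i)) (fst (updates P' ! i)) \<sigma>' \<sigma>)
       (fst \<omega>') (fst \<omega>) \<and>
     (case (snd \<omega>', snd \<omega>) of ((i', \<sigma>'), (i, \<sigma>)) \<Rightarrow> i = i' \<and>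
         refines_valuation (fst (queries P ! i)) (fst (queries P' ! i)) \<sigma>' \<sigma>)"

definition project_program ::
    "'a list \<Rightarrow> ('r, 'a, 'x, 'v) program \<Rightarrow> ('r, 'a, 'x, 'v) program"
where
  "project_program L P = P\<lparr>queries := map (\<lambda>(ps, Q). (ps, Proj L Q)) (queries P)\<rparr>"

text \<open>As in the query syntax, the attribute list of a projection is nonempty.\<close>

definition refines ::
    "('s, 'b, 'y, 'v::linorder) program \<Rightarrow> ('r, 'a, 'x, 'v) program \<Rightarrow> bool"
where
  "refines P' P \<longleftrightarrow>
     (\<forall>\<omega> \<omega>'. valid_seq P \<omega> \<and> valid_seq P' \<omega>' \<and> refines_seq P P' \<omega>' \<omega> \<longrightarrow>
        (\<exists>L. L \<noteq> [] \<and> run (project_program L P') \<omega>' = run P \<omega>))"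


section \<open>Simulation invariants\<close>

type_synonym ('r, 'a, 's, 'b, 'v) sim_rel =
  "('r, 'a, 'v) inst \<Rightarrow> ('s, 'b, 'v) inst \<Rightarrow> bool"

definition simulation_invariant ::
    "('r, 'a, 'x, 'v) program \<Rightarrow> ('s, 'b, 'y, 'v) program \<Rightarrow>
     ('r, 'a, 's, 'b, 'v) sim_rel \<Rightarrow> bool"
where
  "simulation_invariant P P' \<Phi> \<longleftrightarrow>
     (\<forall>\<Delta> \<Delta>'. \<Phi> \<Delta> \<Delta>' \<longrightarrow> \<Delta> \<in> instances (schema P) \<and> \<Delta>' \<in> instances (schema P'))"

text \<open>
  Validity of a Hoare triple for the sequential composition of \<open>U\<close> and \<open>U'\<close>, which act on
  separate databases and have separate parameters.
\<close>

definition hoare_valid ::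
    "(('r, 'a, 'v) inst \<Rightarrow> ('x, 'v) valuation \<Rightarrow> ('s, 'b, 'v) inst \<Rightarrow> ('y, 'v) valuation \<Rightarrow> bool) \<Rightarrow>
     ('x, 'v::linorder) params \<times> ('r, 'a, 'x, 'v) update \<Rightarrow>
     ('y, 'v) params \<times> ('s, 'b, 'y, 'v) update \<Rightarrow>
     (('r, 'a, 'v) inst \<Rightarrow> ('x, 'v) valuation \<Rightarrow> ('s, 'b, 'v) inst \<Rightarrow> ('y, 'v) valuation \<Rightarrow> bool) \<Rightarrow>
     bool"
where
  "hoare_valid pre T T' post \<longleftrightarrow>
     (\<forall>\<Delta> \<sigma> \<Delta>' \<sigma>'. valuation_of (fst T) \<sigma> \<and> valuation_of (fst T') \<sigma>' \<and> pre \<Delta> \<sigma> \<Delta>' \<sigma>' \<longrightarrow>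
        post (update_sem \<sigma> (snd T) \<Delta>) \<sigma> (update_sem \<sigma>' (snd T') \<Delta>') \<sigma>')"

definition inductive_invariant ::
    "('r, 'a, 'x, 'v::linorder) program \<Rightarrow> ('s, 'b, 'y, 'v) program \<Rightarrow>
     ('r, 'a, 's, 'b, 'v) sim_rel \<Rightarrow> bool"
where
  "inductive_invariant P P' \<Phi> \<longleftrightarrow>
     \<Phi> empty_inst empty_inst \<and>
     (\<forall>i < length (updates P).
        hoare_valid
          (\<lambda>\<Delta> \<sigma> \<Delta>' \<sigma>'. \<Phi> \<Delta> \<Delta>' \<and>
             refines_valuation (fst (updates P ! i)) (fst (updates P' ! i)) \<sigma>' \<sigma>)
          (updates P ! i) (updates P' ! i)
          (\<lambda>\<Delta> \<sigma> \<Delta>' \<sigma>'. \<Phi> \<Delta> \<Delta>'))"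

definition projectively_sufficient ::
    "('r, 'a, 'x, 'v::linorder) program \<Rightarrow> ('s, 'b, 'y, 'v) program \<Rightarrow>
     ('r, 'a, 's, 'b, 'v) sim_rel \<Rightarrow> bool"
where
  "projectively_sufficient P P' \<Phi> \<longleftrightarrow>
     (\<forall>i < length (queries P). \<forall>\<Delta> \<Delta>' \<sigma> \<sigma>'.
        valuation_of (fst (queries P ! i)) \<sigma> \<and> valuation_of (fst (queries P' ! i)) \<sigma>' \<and>
        \<Phi> \<Delta> \<Delta>' \<and>
        refines_valuation (fst (queries P ! i)) (fst (queries P' ! i)) \<sigma>' \<sigma> \<longrightarrow>
        (\<exists>L. L \<noteq> [] \<and>
           values_of (query_sem \<sigma> \<Delta> (snd (queries P ! i))) =
           values_of (query_sem \<sigma>' \<Delta>' (Proj L (snd (queries P' ! i))))))"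

end

theory Submission
  imports Defs
begin

text \<open>
  The invariant relates exactly the pairs of instances that the two programs reach from the empty
  database by update sequences one of which refines the other. Appending a pair of corresponding
  query invocations to such sequences gives invocation sequences to which refinement applies.
\<close>

abbreviation has_record_type :: "('a, 'v) tuple \<Rightarrow> ('a, 'v) record_type \<Rightarrow> bool" where
  "has_record_type \<equiv> list_all2 (\<lambda>(a, w) (b, T). a = b \<and> w \<in> T)"

text \<open>\<open>AList.update\<close> overwrites the first entry with key \<open>a\<close>. Since
  \<open>a\<close> is an attribute of \<open>rt\<close>, such an entry exists, so nothing is
  appended and the shape of the tuple is kept; since the names are distinct, the type demanded at
  that position is \<open>T\<close>.\<close>

lemma has_record_type_AList_update:
  assumes "has_record_type t rt" "distinct (map fst rt)" "(a, T) \<in> set rt" "w \<in> T"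
  shows "has_record_type (AList.update a w t) rt"
  using assms
proof (induction t rt rule: list_all2_induct)
  case Nil
  then show ?case by simp
next
  case (Cons x t y rt)
  obtain b u c T' where xy: "x = (b, u)" "y = (c, T')"
    by (metis surj_pair)
  show ?case
  proof (cases "a = b")
    case True
    \<comment> \<open>Distinctness keeps \<open>a\<close> out of the tail, so \<open>(a, T)\<close>
      can only be the head of the record type.\<close>
    then have "T' = T"
      using Cons xy by (auto simp: image_iff)
    with True Cons xy show ?thesis by auto
  next
    case False
    with Cons xy show ?thesis by auto
  qed
qed

lemma arg_sem_has_type:
  assumes "valuation_of ps \<sigma>" "arg_has_type ps v T"
  shows "arg_sem \<sigma> v \<in> T"
  using assms by (cases v) (auto simp: valuation_of_def)

lemma instances_fun_upd:
  assumes "\<Delta> \<in> instances S" "S R = Some rt" "\<And>t. t \<in> set ts \<Longrightarrow> has_record_type t rt"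
  shows "\<Delta>(R := ts) \<in> instances S"
proof -
  have "case S R' of None \<Rightarrow> (\<Delta>(R := ts)) R' = []
    | Some rt \<Rightarrow> \<forall>t \<in> set ((\<Delta>(R := ts)) R'). has_record_type t rt" for R'
  proof (cases "R' = R")
    case True
    with assms(2,3) show ?thesis by simp
  next
    case False
    moreover have "case S R' of None \<Rightarrow> \<Delta> R' = []
      | Some rt \<Rightarrow> \<forall>t \<in> set (\<Delta> R'). has_record_type t rt"
      using assms(1) by (simp add: instances_def)
    ultimately show ?thesis by (cases "S R'") simp_all
  qed
  then show ?thesis by (simp add: instances_def)
qed

lemma instances_has_record_type:
  assumes "\<Delta> \<in> instances S" "S R = Some rt" "t \<in> set (\<Delta> R)"
  shows "has_record_type t rt"
proof -
  have "case S R of None \<Rightarrow> \<Delta> R = [] | Some rt \<Rightarrow> \<forall>t \<in> set (\<Delta> R). has_record_type t rt"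
    using assms(1) by (simp add: instances_def)
  with assms(2,3) show ?thesis by simp
qed

text \<open>A simulation invariant may relate only well-typed instances, so typing must survive each
  update. Every atomic update rewrites one relation: the tuples kept were typed already, and new
  values have the type that \<open>wf_update\<close> requires of their argument.\<close>

lemma update_sem_instances:
  assumes "wf_schema S" "wf_update S ps U" "valuation_of ps \<sigma>" "\<Delta> \<in> instances S"
  shows "update_sem \<sigma> U \<Delta> \<in> instances S"
  using assms(2,4)
proof (induction U arbitrary: \<Delta>)
  case (Ins R t)
  then obtain rt where rt: "S R = Some rt"
    and t: "list_all2 (\<lambda>(a, v) (b, T). a = b \<and> arg_has_type ps v T) t rt"
    by auto
  have "has_record_type (map (\<lambda>(a, v). (a, arg_sem \<sigma> v)) t) rt"
    unfolding list_all2_map1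
    using t by (rule list_all2_mono) (auto intro: arg_sem_has_type[OF assms(3)])
  then show ?case
    unfolding update_sem.simps
    by (intro instances_fun_upd[OF Ins.prems(2) rt])
      (use Ins.prems(2) rt in \<open>auto intro: instances_has_record_type\<close>)
next
  case (Del R p)
  then obtain rt where rt: "S R = Some rt" by auto
  show ?case
    unfolding update_sem.simps
    by (intro instances_fun_upd[OF Del.prems(2) rt])
      (use Del.prems(2) rt in \<open>auto intro: instances_has_record_type\<close>)
next
  case (Upd R p a v)
  then obtain rt T where rt: "S R = Some rt" and a: "(a, T) \<in> set rt" and v: "arg_has_type ps v T"
    by auto
  have "distinct (map fst rt)"
    using assms(1) rt by (auto simp: wf_schema_def ran_def)
  then have "has_record_type (AList.update a (arg_sem \<sigma> v) t) rt" if "t \<in> set (\<Delta> R)" for t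
    using that rt a v Upd.prems(2)
    by (blast intro: has_record_type_AList_update instances_has_record_type
        arg_sem_has_type[OF assms(3)])
  then show ?case
    unfolding update_sem.simps
    by (intro instances_fun_upd[OF Upd.prems(2) rt])
      (use Upd.prems(2) rt in \<open>auto intro: instances_has_record_type\<close>)
next
  case (Seq U1 U2)
  then show ?case by simp
qed

lemma empty_inst_in_instances: "empty_inst \<in> instances S"
  by (simp add: instances_def empty_inst_def split: option.split)

text \<open>This is the update half of \<open>valid_seq\<close>, separated because the invariant
  describes instances before any query is invoked.\<close>

definition valid_updates :: "('r, 'a, 'x, 'v) program \<Rightarrow> ('x, 'v) invocation list \<Rightarrow> bool" where
  "valid_updates P us \<longleftrightarrow>
     (\<forall>(i, \<sigma>) \<in> set us. i < length (updates P) \<and> valuation_of (fst (updates P ! i)) \<sigma>)"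

lemma run_updates_Nil [simp]: "run_updates P [] \<Delta> = \<Delta>"
  by (simp add: run_updates_def)

lemma run_updates_snoc [simp]:
  "run_updates P (us @ [(i, \<sigma>)]) \<Delta> = update_sem \<sigma> (snd (updates P ! i)) (run_updates P us \<Delta>)"
  by (simp add: run_updates_def)

lemma run_updates_instances:
  assumes "database_program P" "valid_updates P us" "\<Delta> \<in> instances (schema P)"
  shows "run_updates P us \<Delta> \<in> instances (schema P)"
  using assms(2)
\<comment> \<open>The last invocation is applied last, so peeling it off at the end leaves a typed
  instance to which a single update is applied.\<close>
proof (induction us rule: rev_induct)
  case Nil
  then show ?case using assms(3) by simp
next
  case (snoc u us)
  obtain i \<sigma> where u: "u = (i, \<sigma>)" by (cases u)
  with snoc.prems have "updates P ! i \<in> set (updates P)"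
    and \<sigma>: "valuation_of (fst (updates P ! i)) \<sigma>"
    by (auto simp: valid_updates_def)
  then have "wf_update (schema P) (fst (updates P ! i)) (snd (updates P ! i))"
    using assms(1) by (auto simp: database_program_def split_beta)
  with snoc \<sigma> assms(1) u show ?case
    by (auto simp: database_program_def valid_updates_def intro: update_sem_instances)
qed

text \<open>The \<open>list_all2\<close> condition is the update half of \<open>refines_seq\<close>,
  so a pair of histories becomes a refining pair of invocation sequences as soon as matching queries
  are added.\<close>

definition co_reachable ::
    "('r, 'a, 'x, 'v::linorder) program \<Rightarrow> ('s, 'b, 'y, 'v) program \<Rightarrow>
     ('r, 'a, 's, 'b, 'v) sim_rel"
where
  "co_reachable P P' \<Delta> \<Delta>' \<longleftrightarrow>
     (\<exists>us us'. valid_updates P us \<and> valid_updates P' us' \<and>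
        list_all2 (\<lambda>(i', \<sigma>') (i, \<sigma>). i = i' \<and>
          refines_valuation (fst (updates P ! i)) (fst (updates P' ! i)) \<sigma>' \<sigma>) us' us \<and>
        \<Delta> = run_updates P us empty_inst \<and> \<Delta>' = run_updates P' us' empty_inst)"

lemma co_reachable_simulation_invariant:
  assumes "database_program P" "database_program P'"
  shows "simulation_invariant P P' (co_reachable P P')"
  using assms
  by (auto simp: simulation_invariant_def co_reachable_def
      intro: run_updates_instances empty_inst_in_instances)

lemma co_reachable_update:
  assumes "co_reachable P P' \<Delta> \<Delta>'"
    and "i < length (updates P)" "i < length (updates P')"
    and "valuation_of (fst (updates P ! i)) \<sigma>" "valuation_of (fst (updates P' ! i)) \<sigma>'"
    and "refines_valuation (fst (updates P ! i)) (fst (updates P' ! i)) \<sigma>' \<sigma>"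
  shows "co_reachable P P'
    (update_sem \<sigma> (snd (updates P ! i)) \<Delta>) (update_sem \<sigma>' (snd (updates P' ! i)) \<Delta>')"
proof -
  obtain us us' where us: "valid_updates P us" "valid_updates P' us'"
    "list_all2 (\<lambda>(i', \<sigma>') (i, \<sigma>). i = i' \<and>
       refines_valuation (fst (updates P ! i)) (fst (updates P' ! i)) \<sigma>' \<sigma>) us' us"
    "\<Delta> = run_updates P us empty_inst" "\<Delta>' = run_updates P' us' empty_inst"
    using assms(1) by (auto simp: co_reachable_def)
  show ?thesis
    unfolding co_reachable_def
    \<comment> \<open>The update is recorded as one more invocation, with the same index
      \<open>i\<close>, at the end of both histories.\<close>
    by (rule exI[of _ "us @ [(i, \<sigma>)]"], rule exI[of _ "us' @ [(i, \<sigma>')]"])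
      (use us assms(2-) in \<open>auto simp: valid_updates_def intro!: list_all2_appendI\<close>)
qed

lemma co_reachable_inductive:
  assumes "length (updates P) \<le> length (updates P')"
  shows "inductive_invariant P P' (co_reachable P P')"
proof -
  have "co_reachable P P' empty_inst empty_inst"
    \<comment> \<open>The empty histories serve as witnesses, since the final query is kept apart
      from the list of updates.\<close>
    unfolding co_reachable_def
    by (rule exI[of _ "[]"], rule exI[of _ "[]"]) (simp add: valid_updates_def)
  with assms show ?thesis
    by (auto simp: inductive_invariant_def hoare_valid_def intro: co_reachable_update)
qed

text \<open>\<open>project_program\<close> changes only the queries, so both programs pass through
  the same instances. The bound on \<open>i\<close> lets the lookup commute with
  \<open>map\<close>.\<close>

lemma run_project_program:
  assumes "i < length (queries P)"
  shows "run (project_program L P) (us, (i, \<sigma>)) =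
    values_of (query_sem \<sigma> (run_updates P us empty_inst) (Proj L (snd (queries P ! i))))"
  using assms
  by (simp add: run_def run_from_def project_program_def run_updates_def split_beta)

text \<open>The quantifiers fit: refinement yields an \<open>L\<close> for each pair of sequences,
  and sufficiency lets \<open>L\<close> depend on the instances and valuations. It is enough to pick
  one pair of histories reaching \<Delta> and \<Delta>' and take the \<open>L\<close> that
  refinement gives once the queries are added.\<close>

lemma co_reachable_projectively_sufficient:
  assumes "length (queries P) \<le> length (queries P')" "refines P' P"
  shows "projectively_sufficient P P' (co_reachable P P')"
  unfolding projectively_sufficient_def
proof (intro allI impI, elim conjE)
  fix i \<Delta> \<Delta>' \<sigma> \<sigma>'
  assume i: "i < length (queries P)"
    and \<sigma>: "valuation_of (fst (queries P ! i)) \<sigma>" "valuation_of (fst (queries P' ! i)) \<sigma>'"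
      "refines_valuation (fst (queries P ! i)) (fst (queries P' ! i)) \<sigma>' \<sigma>"
    and "co_reachable P P' \<Delta> \<Delta>'"
  then obtain us us' where us: "valid_updates P us" "valid_updates P' us'"
    "list_all2 (\<lambda>(i', \<sigma>') (i, \<sigma>). i = i' \<and>
       refines_valuation (fst (updates P ! i)) (fst (updates P' ! i)) \<sigma>' \<sigma>) us' us"
    and \<Delta>: "\<Delta> = run_updates P us empty_inst" "\<Delta>' = run_updates P' us' empty_inst"
    by (auto simp: co_reachable_def)
  have i': "i < length (queries P')"
    using i assms(1) by simp
  have "valid_seq P (us, (i, \<sigma>))" "valid_seq P' (us', (i, \<sigma>'))"
    "refines_seq P P' (us', (i, \<sigma>')) (us, (i, \<sigma>))"
    using us \<sigma> i i' by (auto simp: valid_seq_def valid_updates_def refines_seq_def)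
  then obtain L where "L \<noteq> []" "run (project_program L P') (us', (i, \<sigma>')) = run P (us, (i, \<sigma>))"
    using assms(2) unfolding refines_def by blast
  \<comment> \<open>Both runs now unfold to the values of the query results on \<Delta> and
    \<Delta>'.\<close>
  then show "\<exists>L. L \<noteq> [] \<and> values_of (query_sem \<sigma> \<Delta> (snd (queries P ! i))) =
      values_of (query_sem \<sigma>' \<Delta>' (Proj L (snd (queries P' ! i))))"
    unfolding run_project_program[OF i'] \<Delta> by (auto simp: run_def run_from_def)
qed

theorem theorem4p8:
  fixes P :: "('r, 'a, 'x, 'v::linorder) program"
    and P' :: "('s, 'b, 'y, 'v) program"
  assumes "database_program P"
    and "database_program P'"
    and "length (updates P) \<le> length (updates P')"
    and "length (queries P) \<le> length (queries P')"
    and "params_correspond P P'"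
    and "refines P' P"
  shows "\<exists>\<Phi>. simulation_invariant P P' \<Phi> \<and>
             inductive_invariant P P' \<Phi> \<and>
             projectively_sufficient P P' \<Phi>"
  using assms co_reachable_simulation_invariant co_reachable_inductive
    co_reachable_projectively_sufficient
  by blast

end
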